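(* Let $\lambda>1$ be a natural number, let $\varepsilon>0$ be a real parameter and let $M\in\mathbb{R}\setminus\{0\}$. Put $e_3^{|M|}:=(0,0,|M|)$ and $C(x,y,z):=\frac12(x^2+y^2+z^2)$. The following perturbation of the rattleback system $\dot x=\lambda xz,\ \dot y=-yz,\ \dot z=y^2-\lambda x^2$, $$p_{het}:\quad \begin{bmatrix}\dot x\\ \dot y\\ \dot z\end{bmatrix}=\begin{bmatrix}\lambda xz\\ -yz\\ y^2-\lambda x^2\end{bmatrix}+\varepsilon\,xy^{2\lambda-1}\begin{bmatrix} y(\lambda x^2-y^2-z^2)\\ x(-\lambda x^2+y^2-\lambda z^2)\\ (\lambda+1)xyz\end{bmatrix},\qquad (x,y,z)\in\mathbb{R}^3,$$ asymptotically stabilizes the set of heteroclinic cycles of the rattleback system generated by the unstable equilibrium states $-e_3^{|M|}$ and $e_3^{|M|}$, with respect to perturbations along the invariant manifold $C^{-1}(\{M^2/2\})$.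
   Context: The set of heteroclinic cycles of the rattleback system generated by $-e_3^{|M|},e_3^{|M|}$ is the invariant set $$\mathcal{EC}^{-1}(\{(0,M^2/2)\})=\{(x,y,z)\in\mathbb{R}^3: xy^{\lambda}=0,\ x^2+y^2+z^2=M^2\},\qquad \mathcal{EC}(x,y,z):=(xy^{\lambda},C(x,y,z)),$$ which consists of the two unstable equilibria $\pm e_3^{|M|}$ and the four heteroclinic orbits connecting them. The function $C$ is a first integral of both the rattleback system and $p_{het}$. The system $p_{het}$ asymptotically stabilizes this set with respect to perturbations along $C^{-1}(\{M^2/2\})$ if its dynamical elements (the two equilibria and the four heteroclinic orbits) keep their nature as dynamical elements of $p_{het}$, and the set is an asymptotically stable invariant set (stable and locally attracting) for the dynamics of $p_{het}$ restricted to the sphere $C^{-1}(\{M^2/2\})$. *)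

theory Defs
  imports "HOL-Analysis.Analysis"
begin

type_synonym R3 = "real \<times> real \<times> real"

definition solution :: "('a::real_normed_vector \<Rightarrow> 'a) \<Rightarrow> real set \<Rightarrow> (real \<Rightarrow> 'a) \<Rightarrow> bool" where
  "solution f T u \<longleftrightarrow> (\<forall>t\<in>T. (u has_vector_derivative f (u t)) (at t within T))"

definition invariant_set :: "('a::real_normed_vector \<Rightarrow> 'a) \<Rightarrow> 'a set \<Rightarrow> bool" where
  "invariant_set f S \<longleftrightarrow>
     (\<forall>T u. is_interval T \<and> 0 \<in> T \<and> solution f T u \<and> u 0 \<in> S \<longrightarrow> u ` T \<subseteq> S)"

(* Stability and attraction of K for the dynamics restricted to S (an invariant set of f);
   neighbourhoods of K are taken relative to S. Stability is required of all local
   forward solutions, so it does not presuppose global existence. *)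
definition stable_on :: "('a::real_normed_vector \<Rightarrow> 'a) \<Rightarrow> 'a set \<Rightarrow> 'a set \<Rightarrow> bool" where
  "stable_on f S K \<longleftrightarrow>
     (\<forall>U. openin (top_of_set S) U \<and> K \<subseteq> U \<longrightarrow>
       (\<exists>V. openin (top_of_set S) V \<and> K \<subseteq> V \<and>
         (\<forall>T u. T \<ge> 0 \<and> solution f {0..T} u \<and> u 0 \<in> V \<longrightarrow> u ` {0..T} \<subseteq> U)))"

(* The existence clause rules out vacuous attraction through finite-time blow-up. *)
definition locally_attracting_on :: "('a::real_normed_vector \<Rightarrow> 'a) \<Rightarrow> 'a set \<Rightarrow> 'a set \<Rightarrow> bool" where
  "locally_attracting_on f S K \<longleftrightarrow>
     (\<exists>V. openin (top_of_set S) V \<and> K \<subseteq> V \<and>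
       (\<forall>a\<in>V. (\<exists>u. solution f {0..} u \<and> u 0 = a) \<and>
         (\<forall>u. solution f {0..} u \<and> u 0 = a \<longrightarrow>
           ((\<lambda>t. infdist (u t) K) \<longlongrightarrow> 0) at_top)))"

definition asymptotically_stable_invariant_on ::
    "('a::real_normed_vector \<Rightarrow> 'a) \<Rightarrow> 'a set \<Rightarrow> 'a set \<Rightarrow> bool" where
  "asymptotically_stable_invariant_on f S K \<longleftrightarrow>
     K \<subseteq> S \<and> invariant_set f K \<and> stable_on f S K \<and> locally_attracting_on f S K"

definition unstable_equilibrium :: "('a::real_normed_vector \<Rightarrow> 'a) \<Rightarrow> 'a \<Rightarrow> bool" where
  "unstable_equilibrium f p \<longleftrightarrow> f p = 0 \<and> \<not> stable_on f UNIV {p}"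

definition heteroclinic_orbits ::
    "('a::real_normed_vector \<Rightarrow> 'a) \<Rightarrow> 'a \<Rightarrow> 'a \<Rightarrow> 'a set set" where
  "heteroclinic_orbits f p q =
     {range u | u. p \<noteq> q \<and> f p = 0 \<and> f q = 0 \<and> solution f UNIV u \<and>
        (u \<longlongrightarrow> p) at_bot \<and> (u \<longlongrightarrow> q) at_top}"

definition heteroclinic_cycles :: "('a::real_normed_vector \<Rightarrow> 'a) \<Rightarrow> 'a \<Rightarrow> 'a \<Rightarrow> 'a set" where
  "heteroclinic_cycles f p q =
     {p, q} \<union> \<Union>(heteroclinic_orbits f p q \<union> heteroclinic_orbits f q p)"

(* The system g asymptotically stabilizes the set K of heteroclinic cycles of f generated by
   the unstable equilibria p and q, with respect to perturbations along S. The inclusions of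
   heteroclinic orbits say that each connecting orbit of f is, as a set and with the same
   direction, a connecting orbit of g. *)
definition asymptotically_stabilizes_cycles ::
    "('a::real_normed_vector \<Rightarrow> 'a) \<Rightarrow> ('a \<Rightarrow> 'a) \<Rightarrow> 'a \<Rightarrow> 'a \<Rightarrow> 'a set \<Rightarrow> 'a set \<Rightarrow> bool" where
  "asymptotically_stabilizes_cycles f g p q K S \<longleftrightarrow>
     unstable_equilibrium f p \<and> unstable_equilibrium f q \<and>
     K = heteroclinic_cycles f p q \<and>
     invariant_set f S \<and> invariant_set g S \<and>
     unstable_equilibrium g p \<and> unstable_equilibrium g q \<and>
     heteroclinic_orbits f p q \<subseteq> heteroclinic_orbits g p q \<and>
     heteroclinic_orbits f q p \<subseteq> heteroclinic_orbits g q p \<and>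
     asymptotically_stable_invariant_on g S K"

definition rattleback :: "nat \<Rightarrow> R3 \<Rightarrow> R3" where
  "rattleback l = (\<lambda>(x, y, z). (real l * x * z, - y * z, y\<^sup>2 - real l * x\<^sup>2))"

definition p_het :: "nat \<Rightarrow> real \<Rightarrow> R3 \<Rightarrow> R3" where
  "p_het l \<epsilon> = (\<lambda>(x, y, z).
     rattleback l (x, y, z) + (\<epsilon> * x * y ^ (2 * l - 1)) *\<^sub>R
       (y * (real l * x\<^sup>2 - y\<^sup>2 - z\<^sup>2),
        x * (- real l * x\<^sup>2 + y\<^sup>2 - real l * z\<^sup>2),
        (real l + 1) * x * y * z))"

definition Casimir :: "R3 \<Rightarrow> real" where
  "Casimir = (\<lambda>(x, y, z). (x\<^sup>2 + y\<^sup>2 + z\<^sup>2) / 2)"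

definition energy_Casimir :: "nat \<Rightarrow> R3 \<Rightarrow> real \<times> real" where
  "energy_Casimir l = (\<lambda>(x, y, z). (x * y ^ l, Casimir (x, y, z)))"

definition e3 :: "real \<Rightarrow> R3" where
  "e3 r = (0, 0, r)"

end

theory Submission
  imports Defs
begin

text \<open>
  Everything rests on the function \<open>P = x y\<^sup>l\<close>, a first integral of the rattleback. Along the
  perturbed system its derivative is \<open>- \<epsilon> P d\<close> with
  \<open>d = y\<^bsup>2(l-1)\<^esup> ((l x\<^sup>2 - y\<^sup>2)\<^sup>2 + z\<^sup>2 (y\<^sup>2 + l\<^sup>2 x\<^sup>2)) \<ge> 0\<close>, so \<open>P\<^sup>2\<close> never increases, while the
  norm stays a first integral (lemma \<open>spin_product_square_derivative\<close>). The set to be stabilized is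
  exactly the zero set of \<open>P\<^sup>2\<close> on a sphere. Because the sphere is compact, small sublevel sets of
  \<open>P\<^sup>2\<close> lie in any prescribed neighbourhood of this zero set, which gives stability
  (\<open>Lyapunov_stable_on\<close>). Where \<open>P \<noteq> 0\<close>, the factor \<open>d\<close> vanishes on the sphere only if
  \<open>z = 0\<close> and \<open>y\<^sup>2 = l x\<^sup>2\<close>; at these points \<open>P\<^sup>2\<close> has one and the same value \<open>c > 0\<close> (\<open>dissipation_pos\<close>). Hence on
  \<open>{\<eta> \<le> P\<^sup>2 \<le> P\<^sup>2(a)}\<close> with \<open>P\<^sup>2(a) < c\<close> the decay rate is bounded away from zero, and
  every solution starting in \<open>{P\<^sup>2 < c}\<close> is attracted (\<open>Lyapunov_locally_attracting_on\<close>).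

  On the zero set of \<open>P\<close> the perturbation vanishes, since its factor \<open>x y\<^bsup>2l-1\<^esup>\<close> does. Thus the
  connecting orbits of the rattleback are connecting orbits of the perturbed system. They are
  explicit: the sphere meets each of the planes \<open>x = 0\<close> and \<open>y = 0\<close> in a great circle, whose open
  halves are run through by sech-tanh solutions, in opposite directions in the two planes. No
  connecting orbit leaves the zero set, because \<open>P\<close> and the norm are constant along
  rattleback solutions and take their limit values at the equilibria. Each equilibrium is the source of a connecting orbit, and
  this alone makes it unstable (\<open>heteroclinic_orbit_source_unstable\<close>).

  Attraction includes the existence of forward solutions for all time. The perturbed field is
  orthogonal to the position vector, so it may be cut off outside a ball that its solutions never
  leave; the cut-off field is globally Lipschitz and a contraction argument applies
  (\<open>lipschitz_global_solution\<close>, \<open>orthogonal_field_global_solution\<close>).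
\<close>

section \<open>Global solutions of norm-preserving vector fields\<close>

text \<open>A primitive of a function of growth \<open>exp (\<kappa> s)\<close> has the same growth, its constant multiplied
  by \<open>1 / \<kappa>\<close>. This makes Picard iteration a contraction in an exponentially weighted norm.\<close>

lemma integral_exp_bound:
  fixes h :: "real \<Rightarrow> 'a::euclidean_space"
  assumes "continuous_on UNIV h" "\<kappa> > 0" "t \<ge> 0"
    and bound: "\<And>s. s \<in> {0..t} \<Longrightarrow> norm (h s) \<le> B * exp (\<kappa> * s)"
  shows "exp (- \<kappa> * t) * norm (integral {0..t} h) \<le> B / \<kappa>"
proof -
  have "B * exp (\<kappa> * 0) \<ge> norm (h 0)"
    using bound[of 0] \<open>t \<ge> 0\<close> by simp
  then have "B \<ge> 0"
    using norm_ge_zero[of "h 0"] by (simp del: norm_ge_zero)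
  have int: "((\<lambda>s. B * exp (\<kappa> * s)) has_integral (B * exp (\<kappa> * t) / \<kappa> - B * exp (\<kappa> * 0) / \<kappa>)) {0..t}"
    using \<open>\<kappa> > 0\<close> \<open>t \<ge> 0\<close>
    by (intro fundamental_theorem_of_calculus)
      (auto intro!: derivative_eq_intros simp: has_real_derivative_iff_has_vector_derivative[symmetric])
  have "norm (integral {0..t} h) \<le> integral {0..t} (\<lambda>s. B * exp (\<kappa> * s))"
    using assms(1) bound int
    by (intro integral_norm_bound_integral integrable_continuous_real)
      (auto intro!: continuous_intros intro: continuous_on_subset)
  also have "\<dots> = B * exp (\<kappa> * t) / \<kappa> - B / \<kappa>"
    using integral_unique[OF int] by simp
  also have "\<dots> \<le> B * exp (\<kappa> * t) / \<kappa>"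
    using \<open>B \<ge> 0\<close> \<open>\<kappa> > 0\<close> by simp
  finally have "exp (- \<kappa> * t) * norm (integral {0..t} h) \<le> exp (- \<kappa> * t) * (B * exp (\<kappa> * t) / \<kappa>)"
    by (intro mult_left_mono) auto
  also have "\<dots> = B / \<kappa>"
    by (simp add: exp_minus field_simps)
  finally show ?thesis .
qed

lemma indefinite_integral_has_vector_derivative:
  fixes h :: "real \<Rightarrow> 'a::euclidean_space"
  assumes "continuous_on UNIV h" "t \<ge> 0"
  shows "((\<lambda>t. integral {0..t} h) has_vector_derivative h t) (at t within {0..})"
proof -
  have "((\<lambda>t. integral {0..t} h) has_vector_derivative h t) (at t within {0..t+1})"
    using assms by (intro integral_has_vector_derivative) (auto intro: continuous_on_subset)
  moreover have "at t within {0..t+1} = at t within {0..}"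
    by (rule at_within_nhd[of _ "{..<t+1}"]) auto
  ultimately show ?thesis by simp
qed

text \<open>Picard iteration on the whole half-line at once. The unknown is
  \<open>v t = exp (- \<kappa> t) (u t - a)\<close>, which is bounded when \<open>u\<close> solves the equation and
  \<open>\<kappa>\<close> exceeds the Lipschitz constant \<open>K\<close>; the integral equation becomes a fixed point problem for
  bounded continuous functions, with contraction constant \<open>K / \<kappa>\<close>.\<close>

lemma lipschitz_global_solution:
  fixes f :: "'a::euclidean_space \<Rightarrow> 'a"
  assumes "L-lipschitz_on UNIV f"
  obtains u where "solution f {0..} u" "u 0 = a"
proof -
  \<comment> \<open>Shifting by 1 keeps the constant positive, so that it can be divided by.\<close>
  define K where "K = L + 1"
  have K: "K > 0" and Lip: "norm (f x - f y) \<le> K * norm (x - y)" for x y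
  proof -
    show "K > 0"
      using lipschitz_on_nonneg[OF assms] by (simp add: K_def)
    have "norm (f x - f y) \<le> L * norm (x - y)"
      by (rule lipschitz_on_normD[OF assms]) auto
    also have "\<dots> \<le> K * norm (x - y)"
      by (intro mult_right_mono) (auto simp: K_def)
    finally show "norm (f x - f y) \<le> K * norm (x - y)" .
  qed
  have contf: "continuous_on UNIV f"
    using assms by (rule lipschitz_on_continuous_on)
  define \<kappa> where "\<kappa> = 2 * K"
  have \<kappa>: "\<kappa> > 0" using K by (simp add: \<kappa>_def)
  define h where "h v s = f (a + exp (\<kappa> * s) *\<^sub>R apply_bcontfun v s)" for v :: "real \<Rightarrow>\<^sub>C 'a" and s
  have conth: "continuous_on UNIV (h v)" for v
    unfolding h_def by (intro continuous_intros continuous_on_compose2[OF contf]) auto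
  \<comment> \<open>Bounded continuous functions live on the whole line, so the operator is frozen at
    time 0 for negative times.\<close>
  define G where "G v t = exp (- \<kappa> * max 0 t) *\<^sub>R integral {0..max 0 t} (h v)" for v t
  have G_bcont: "G v \<in> bcontfun" for v
  proof (rule bcontfun_normI)
    have "continuous_on {0..} (\<lambda>t. integral {0..t} (h v))"
      using indefinite_integral_has_vector_derivative[OF conth, of _ v]
      by (auto simp: continuous_on_eq_continuous_within intro!: has_vector_derivative_continuous)
    then have "continuous_on UNIV (\<lambda>t. integral {0..max 0 t} (h v))"
      by (rule continuous_on_compose2) (auto intro!: continuous_intros)
    then show "continuous_on UNIV (G v)"
      unfolding G_def by (intro continuous_intros)
    fix t :: real
    have "norm (h v s) \<le> (norm (f a) + K * norm v) * exp (\<kappa> * s)" if "s \<in> {0..max 0 t}" for s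
    proof -
      have "norm (h v s) \<le> norm (f a) + norm (h v s - f a)"
        by (metis add.commute diff_add_cancel norm_triangle_ineq)
      also have "norm (h v s - f a) \<le> K * (exp (\<kappa> * s) * norm (apply_bcontfun v s))"
        using Lip[of "a + exp (\<kappa> * s) *\<^sub>R apply_bcontfun v s" a] by (simp add: h_def)
      also have "\<dots> \<le> K * (exp (\<kappa> * s) * norm v)"
        using K by (intro mult_left_mono norm_bounded) auto
      also have "norm (f a) \<le> norm (f a) * exp (\<kappa> * s)"
        using that \<kappa> by (simp add: mult_le_cancel_left1)
      finally show ?thesis by (simp add: algebra_simps)
    qed
    then show "norm (G v t) \<le> (norm (f a) + K * norm v) / \<kappa>"
      unfolding G_def norm_scaleR using integral_exp_bound[OF conth \<kappa>, of "max 0 t"] by simp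
  qed
  define \<Phi> where "\<Phi> v = Bcontfun (G v)" for v
  have \<Phi>: "apply_bcontfun (\<Phi> v) t = G v t" for v t
    by (simp add: \<Phi>_def Bcontfun_inverse[OF G_bcont])
  have "dist (\<Phi> v) (\<Phi> w) \<le> 1/2 * dist v w" for v w
  proof (rule dist_bound)
    fix t :: real
    have "norm (h v s - h w s) \<le> (K * dist v w) * exp (\<kappa> * s)" for s
    proof -
      have "norm (h v s - h w s) \<le> K * norm (exp (\<kappa> * s) *\<^sub>R (apply_bcontfun v s - apply_bcontfun w s))"
        using Lip[of "a + exp (\<kappa> * s) *\<^sub>R apply_bcontfun v s" "a + exp (\<kappa> * s) *\<^sub>R apply_bcontfun w s"]
        by (simp add: h_def scaleR_diff_right)
      also have "\<dots> \<le> K * (exp (\<kappa> * s) * dist v w)"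
        using K dist_bounded[of v s w] by (simp add: dist_norm)
      finally show ?thesis by (simp add: algebra_simps)
    qed
    then have "exp (- \<kappa> * max 0 t) * norm (integral {0..max 0 t} (\<lambda>s. h v s - h w s)) \<le> K * dist v w / \<kappa>"
      by (intro integral_exp_bound continuous_intros conth \<kappa>) auto
    moreover have "integral {0..max 0 t} (\<lambda>s. h v s - h w s)
        = integral {0..max 0 t} (h v) - integral {0..max 0 t} (h w)"
      using conth by (intro integral_diff integrable_continuous_real) (auto intro: continuous_on_subset)
    ultimately show "dist (apply_bcontfun (\<Phi> v) t) (apply_bcontfun (\<Phi> w) t) \<le> 1/2 * dist v w"
      unfolding \<Phi> G_def dist_norm[of "_ *\<^sub>R _"] scaleR_diff_right[symmetric] norm_scaleR
      using K by (simp add: \<kappa>_def)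
  qed
  then obtain v where v: "\<Phi> v = v"
    using banach_fix_type[of "1/2" \<Phi>] by auto
  define u where "u t = a + integral {0..t} (h v)" for t
  have "h v t = f (u t)" if "t \<ge> 0" for t
  proof -
    have "exp (\<kappa> * t) *\<^sub>R apply_bcontfun v t = integral {0..t} (h v)"
      using \<Phi>[of v t] that by (simp add: v G_def exp_minus)
    then show ?thesis by (simp add: h_def u_def)
  qed
  then have "solution f {0..} u"
    using indefinite_integral_has_vector_derivative[OF conth, of _ v]
    by (auto simp: solution_def u_def[abs_def] has_vector_derivative_add_const add.commute[of a])
  moreover have "u 0 = a" by (simp add: u_def)
  ultimately show thesis by (rule that)
qed

lemma solution_subset: "solution f T u \<Longrightarrow> S \<subseteq> T \<Longrightarrow> solution f S u"
  unfolding solution_def by (meson has_vector_derivative_within_subset subsetD)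

text \<open>The derivative of \<open>u \<bullet> u\<close> is \<open>2 (f u \<bullet> u)\<close>.\<close>

lemma orthogonal_solution_norm_constant:
  fixes f :: "'a::real_inner \<Rightarrow> 'a"
  assumes "solution f T u" "is_interval T" "\<And>p. f p \<bullet> p = 0" "s \<in> T" "t \<in> T"
  shows "norm (u s) = norm (u t)"
proof -
  have "((\<lambda>t. u t \<bullet> u t) has_vector_derivative 0) (at t within T)" if "t \<in> T" for t
  proof -
    have "(u has_derivative (\<lambda>h. h *\<^sub>R f (u t))) (at t within T)"
      using assms(1) that by (simp add: solution_def has_vector_derivative_def)
    from has_derivative_inner[OF this this] show ?thesis
      unfolding has_vector_derivative_def
      by (rule has_derivative_eq_rhs) (simp add: assms(3) inner_commute[of "u t"])
  qed
  then obtain c where "\<And>t. t \<in> T \<Longrightarrow> u t \<bullet> u t = c"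
    by (rule has_vector_derivative_zero_constant[OF is_interval_convex[OF assms(2)]]) blast+
  then show ?thesis using assms by (simp add: norm_eq_sqrt_inner)
qed

text \<open>Composing \<open>f\<close> with the nearest-point projection onto a ball makes it globally Lipschitz. Outside
  the ball the projection only rescales its argument, so the new field is still orthogonal to the
  position vector; its solution from \<open>a\<close> therefore stays in the ball, where the two fields agree.\<close>

lemma orthogonal_field_global_solution:
  fixes f :: "'a::euclidean_space \<Rightarrow> 'a"
  assumes lip: "\<And>R. \<exists>L. L-lipschitz_on (cball 0 R) f"
    and orth: "\<And>p. f p \<bullet> p = 0"
  obtains u where "solution f {0..} u" "u 0 = a"
proof -
  \<comment> \<open>The radius must be positive: projection to a ball of radius 0 would not preserve directions.\<close>
  define R where "R = norm a + 1"
  define \<pi> where "\<pi> = closest_point (cball (0::'a) R)"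
  have "R > 0" by (simp add: R_def add_nonneg_pos)
  then have R: "cball (0::'a) R \<noteq> {}" by simp
  have \<pi>_in: "\<pi> p \<in> cball 0 R" for p
    unfolding \<pi>_def using R by (intro closest_point_in_set) auto
  have \<pi>_fix: "\<pi> p = p" if "norm p \<le> R" for p
    unfolding \<pi>_def using that by (intro closest_point_self) auto
  have \<pi>_out: "\<pi> p = (R / norm p) *\<^sub>R p" if "norm p > R" for p
  proof -
    have "norm p > 0" "R \<ge> 0" using that \<open>R > 0\<close> by auto
    have "p - (R / norm p) *\<^sub>R p = (1 - R / norm p) *\<^sub>R p"
      by (simp add: scaleR_diff_left)
    then have "norm (p - (R / norm p) *\<^sub>R p) = \<bar>1 - R / norm p\<bar> * norm p"
      by (simp only: norm_scaleR)
    then have "dist p ((R / norm p) *\<^sub>R p) = norm p - R"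
      using that \<open>norm p > 0\<close> by (simp add: dist_norm abs_if left_diff_distrib)
    then have "\<forall>z\<in>cball 0 R. dist p ((R / norm p) *\<^sub>R p) \<le> dist p z"
      using norm_triangle_ineq2[of p] by (smt (verit) dist_norm mem_cball_0)
    then show ?thesis
      unfolding \<pi>_def using \<open>norm p > 0\<close> \<open>R \<ge> 0\<close>
      by (intro closest_point_unique[symmetric]) auto
  qed
  obtain L where L: "L-lipschitz_on (cball 0 R) f" using lip by blast
  have "1-lipschitz_on UNIV \<pi>"
    using R closest_point_lipschitz[of "cball (0::'a) R"] by (intro lipschitz_onI) (auto simp: \<pi>_def)
  moreover have "L-lipschitz_on (range \<pi>) f"
    using \<pi>_in by (intro lipschitz_on_subset[OF L]) auto
  ultimately have "(L * 1)-lipschitz_on UNIV (\<lambda>p. f (\<pi> p))"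
    by (intro lipschitz_on_compose2)
  then obtain u where u: "solution (\<lambda>p. f (\<pi> p)) {0..} u" "u 0 = a"
    by (rule lipschitz_global_solution)
  have "f (\<pi> p) \<bullet> p = 0" for p
  proof (cases "norm p \<le> R")
    case True
    then show ?thesis using orth[of p] \<pi>_fix[of p] by simp
  next
    case False
    then show ?thesis using orth[of "\<pi> p"] \<pi>_out[of p] \<open>R > 0\<close> by auto
  qed
  then have "norm (u t) \<le> R" if "t \<ge> 0" for t
    using orthogonal_solution_norm_constant[OF u(1), of t 0] that by (simp add: u(2) R_def is_interval_ci)
  then have "f (\<pi> (u t)) = f (u t)" if "t \<ge> 0" for t
    using \<pi>_fix that by metis
  then have "solution f {0..} u"
    using u(1) unfolding solution_def by (metis atLeast_iff)
  then show thesis using u(2) by (rule that)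
qed

section \<open>Instability at the source of a heteroclinic orbit\<close>

lemma heteroclinic_orbitE:
  assumes "X \<in> heteroclinic_orbits f p q"
  obtains u where "p \<noteq> q" "f p = 0" "X = range u" "solution f UNIV u" "(u \<longlongrightarrow> p) at_bot" "(u \<longlongrightarrow> q) at_top"
  using assms unfolding heteroclinic_orbits_def by blast

lemma solution_shift:
  assumes "solution f UNIV u"
  shows "solution f UNIV (\<lambda>t. u (t + s))"
proof -
  have "((\<lambda>t. u (t + s)) has_vector_derivative f (u (t + s))) (at t)" for t
    using assms vector_diff_chain_at[of "\<lambda>t. t + s" 1 t u "f (u (t + s))"]
    by (simp add: solution_def o_def has_vector_derivative_add_const)
  then show ?thesis by (simp add: solution_def)
qed

text \<open>The orbit passes arbitrarily close to \<open>p\<close> and later comes close to \<open>q\<close>, so it leaves every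
  neighbourhood of \<open>p\<close> whose complement contains a neighbourhood of \<open>q\<close>.\<close>

lemma heteroclinic_orbit_source_unstable:
  assumes "heteroclinic_orbits f p q \<noteq> {}"
  shows "unstable_equilibrium f p"
proof -
  from assms obtain X where X: "X \<in> heteroclinic_orbits f p q" by blast
  obtain u where "p \<noteq> q" "f p = 0" and u: "solution f UNIV u"
    and lim: "(u \<longlongrightarrow> p) at_bot" "(u \<longlongrightarrow> q) at_top"
    by (rule heteroclinic_orbitE[OF X])
  from hausdorff[OF \<open>p \<noteq> q\<close>] obtain U W where
    UW: "open U" "open W" "p \<in> U" "q \<in> W" "U \<inter> W = {}" by blast
  have "\<not> stable_on f UNIV {p}"
  proof
    assume "stable_on f UNIV {p}"
    then obtain V where "open V" "p \<in> V"
      and V: "\<And>T v. T \<ge> 0 \<Longrightarrow> solution f {0..T} v \<Longrightarrow> v 0 \<in> V \<Longrightarrow> v ` {0..T} \<subseteq> U"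
      using UW unfolding stable_on_def by (force simp: openin_open_eq)
    have "eventually (\<lambda>t. u t \<in> V) at_bot"
      using lim(1) \<open>open V\<close> \<open>p \<in> V\<close> by (rule topological_tendstoD)
    then obtain s where s: "u s \<in> V" by (auto simp: eventually_at_bot_linorder)
    have "eventually (\<lambda>t. u t \<in> W \<and> t \<ge> s) at_top"
      using topological_tendstoD[OF lim(2) \<open>open W\<close> \<open>q \<in> W\<close>] eventually_ge_at_top
      by (rule eventually_conj)
    then obtain t where t: "u t \<in> W" "t \<ge> s" by (auto simp: eventually_at_top_linorder)
    have "(\<lambda>\<tau>. u (\<tau> + s)) ` {0..t - s} \<subseteq> U"
      using s t by (intro V solution_subset[OF solution_shift[OF u]]) auto
    moreover have "t - s \<in> {0..t - s}" using t(2) by simp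
    ultimately have "u (t - s + s) \<in> U" by blast
    then show False using t(1) UW by auto
  qed
  then show ?thesis using \<open>f p = 0\<close> by (simp add: unstable_equilibrium_def)
qed

section \<open>Lyapunov functions on compact invariant sets\<close>

lemma increment_le_within:
  fixes g :: "real \<Rightarrow> real"
  assumes "is_interval T" "s \<in> T" "t \<in> T" "s \<le> t"
    and der: "\<And>\<tau>. \<tau> \<in> T \<Longrightarrow> (g has_real_derivative g' \<tau>) (at \<tau> within T)"
    and bound: "\<And>\<tau>. \<tau> \<in> {s..t} \<Longrightarrow> g' \<tau> \<le> B"
  shows "g t \<le> g s + B * (t - s)"
proof (cases "s = t")
  case False
  with \<open>s \<le> t\<close> have "s < t" by simp
  have sub: "{s..t} \<subseteq> T"
    using mem_is_interval_1_I[OF assms(1-3)] by auto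
  have "(g has_real_derivative g' x) (at x within {s..t})" if "s \<le> x" "x \<le> t" for x
  proof -
    have "x \<in> T" using sub that by auto
    from has_field_derivative_subset[OF der[OF this] sub] show ?thesis .
  qed
  then have "\<exists>x\<in>{s<..<t}. g t - g s = g' x * (t - s)"
    by (intro mvt_simple[OF \<open>s < t\<close>]) (auto simp: has_field_derivative_def)
  then obtain x where "x \<in> {s<..<t}" "g t - g s = g' x * (t - s)" by blast
  moreover have "g' x * (t - s) \<le> B * (t - s)"
    using bound[of x] \<open>x \<in> {s<..<t}\<close> \<open>s < t\<close> by (intro mult_right_mono) auto
  ultimately show ?thesis by linarith
qed simp

text \<open>The function attains its minimum on the compact set \<open>S - U\<close>, where it is positive.\<close>

lemma sublevel_inside_neighbourhood:
  fixes W :: "'a::metric_space \<Rightarrow> real"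
  assumes "compact S" "continuous_on S W" "\<And>p. p \<in> S \<Longrightarrow> W p \<ge> 0"
    and U: "openin (top_of_set S) U" "{p \<in> S. W p = 0} \<subseteq> U"
  shows "\<exists>\<delta>>0. {p \<in> S. W p < \<delta>} \<subseteq> U"
proof (cases "S - U = {}")
  case True
  then show ?thesis by (intro exI[of _ 1]) auto
next
  case False
  obtain V where "open V" "U = S \<inter> V"
    using U(1) unfolding openin_open by blast
  then have "compact (S - U)"
    using compact_diff[OF assms(1), of V] by (simp add: Diff_Int)
  moreover have "continuous_on (S - U) W"
    using assms(2) by (rule continuous_on_subset) auto
  ultimately obtain p where "p \<in> S - U" and p: "\<And>q. q \<in> S - U \<Longrightarrow> W p \<le> W q"
    using continuous_attains_inf[of "S - U" W] False by blast
  then have "W p > 0" using assms(3)[of p] U(2) by (auto simp: order_less_le)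
  moreover have "{q \<in> S. W q < W p} \<subseteq> U"
  proof
    fix q assume "q \<in> {q \<in> S. W q < W p}"
    then show "q \<in> U" using p[of q] by auto
  qed
  ultimately show ?thesis by blast
qed

lemma openin_sublevel:
  fixes W :: "'a::topological_space \<Rightarrow> real"
  assumes "continuous_on S W"
  shows "openin (top_of_set S) {p \<in> S. W p < c}"
proof -
  have "{p \<in> S. W p < c} = S \<inter> W -` {..<c}" by auto
  then show ?thesis using continuous_openin_preimage_gen[OF assms, of "{..<c}"] by simp
qed

lemma Lyapunov_stable_on:
  fixes f :: "'a::real_normed_vector \<Rightarrow> 'a" and W :: "'a \<Rightarrow> real"
  assumes S: "compact S" "invariant_set f S"
    and W: "continuous_on S W" "\<And>p. p \<in> S \<Longrightarrow> W p \<ge> 0"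
    and D: "\<And>p. p \<in> S \<Longrightarrow> D p \<ge> 0"
    and der: "\<And>T u t. solution f T u \<Longrightarrow> t \<in> T \<Longrightarrow>
      ((\<lambda>s. W (u s)) has_real_derivative - D (u t)) (at t within T)"
  shows "stable_on f S {p \<in> S. W p = 0}"
  unfolding stable_on_def
proof (intro allI impI)
  fix U assume U: "openin (top_of_set S) U \<and> {p \<in> S. W p = 0} \<subseteq> U"
  then obtain \<delta> where \<delta>: "\<delta> > 0" "{p \<in> S. W p < \<delta>} \<subseteq> U"
    using sublevel_inside_neighbourhood[OF S(1) W, of U] by blast
  have "u t \<in> U" if "solution f {0..T} u" "u 0 \<in> S" "W (u 0) < \<delta>" "t \<in> {0..T}" for T u t
  proof -
    have "u ` {0..T} \<subseteq> S"
      using S(2) that unfolding invariant_set_def by (auto simp: is_interval_cc)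
    then have inS: "u \<tau> \<in> S" if "\<tau> \<in> {0..T}" for \<tau> using that by blast
    have "W (u t) \<le> W (u 0) + 0 * (t - 0)"
    proof (rule increment_le_within[OF is_interval_cc _ that(4) _ der[OF that(1)]])
      fix \<tau> assume "\<tau> \<in> {0..t}"
      then show "- D (u \<tau>) \<le> 0" using D[OF inS, of \<tau>] that(4) by auto
    qed (use that(4) in auto)
    then show ?thesis using inS[OF that(4)] \<delta>(2) that(3) by auto
  qed
  then show "\<exists>V. openin (top_of_set S) V \<and> {p \<in> S. W p = 0} \<subseteq> V \<and>
      (\<forall>T u. T \<ge> 0 \<and> solution f {0..T} u \<and> u 0 \<in> V \<longrightarrow> u ` {0..T} \<subseteq> U)"
    using \<delta>(1) by (intro exI[of _ "{p \<in> S. W p < \<delta>}"] conjI openin_sublevel W) auto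
qed

text \<open>
  The basin is the sublevel set below \<open>c\<close>. As long as \<open>W\<close> stays above a level \<open>\<eta> > 0\<close>, the
  solution stays in a compact set on which the decay rate \<open>D\<close> has a positive minimum; as \<open>W\<close>
  is nonnegative, this cannot last forever. Below arbitrarily small levels the solution is trapped
  in arbitrarily small neighbourhoods of the zero set.
\<close>

lemma Lyapunov_locally_attracting_on:
  fixes f :: "'a::real_normed_vector \<Rightarrow> 'a" and W :: "'a \<Rightarrow> real"
  assumes S: "compact S" "invariant_set f S"
    and W: "continuous_on S W" "\<And>p. p \<in> S \<Longrightarrow> W p \<ge> 0"
    and D: "continuous_on S D" "\<And>p. p \<in> S \<Longrightarrow> D p \<ge> 0"
    and pos: "c > 0" "\<And>p. p \<in> S \<Longrightarrow> 0 < W p \<Longrightarrow> W p < c \<Longrightarrow> D p > 0"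
    and der: "\<And>T u t. solution f T u \<Longrightarrow> t \<in> T \<Longrightarrow>
      ((\<lambda>s. W (u s)) has_real_derivative - D (u t)) (at t within T)"
    and ex: "\<And>a. a \<in> S \<Longrightarrow> \<exists>u. solution f {0..} u \<and> u 0 = a"
  shows "locally_attracting_on f S {p \<in> S. W p = 0}" (is "locally_attracting_on f S ?K")
proof -
  have lim: "((\<lambda>t. infdist (u t) ?K) \<longlongrightarrow> 0) at_top"
    if u: "solution f {0..} u" and u0: "u 0 \<in> S" "W (u 0) < c" for u
  proof -
    have inS: "u t \<in> S" if "t \<ge> 0" for t
      using S(2) u u0(1) that unfolding invariant_set_def
      by (metis atLeast_iff image_subset_iff is_interval_ci order_refl)
    have decr: "W (u t) \<le> W (u s) + B * (t - s)"
      if "0 \<le> s" "s \<le> t" "\<And>\<tau>. \<tau> \<in> {s..t} \<Longrightarrow> - D (u \<tau>) \<le> B" for s t B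
      by (rule increment_le_within[OF is_interval_ci _ _ that(2) der[OF u]]) (use that in auto)
    have mono: "W (u t) \<le> W (u s)" if "0 \<le> s" "s \<le> t" for s t
      using decr[of s t 0] that inS D(2) by auto
    have reach: "\<exists>t\<ge>0. W (u t) < \<eta>" if "\<eta> > 0" for \<eta>
    proof (rule ccontr)
      assume "\<not> ?thesis"
      then have ge: "W (u t) \<ge> \<eta>" if "t \<ge> 0" for t using that by force
      define A where "A = S \<inter> W -` {\<eta>..W (u 0)}"
      have "closedin (top_of_set S) A"
        unfolding A_def using W(1) by (intro continuous_closedin_preimage) auto
      then have "compact A" using S(1) by (metis closedin_compact)
      moreover have uA: "u t \<in> A" if "t \<ge> 0" for t
        using that ge mono[of 0 t] inS by (auto simp: A_def)
      moreover have "continuous_on A D"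
        using D(1) by (rule continuous_on_subset) (auto simp: A_def)
      ultimately obtain p where "p \<in> A" and p: "\<And>q. q \<in> A \<Longrightarrow> D p \<le> D q"
        using continuous_attains_inf[of A D] by (metis empty_iff order_refl)
      then have "D p > 0" using pos(2)[of p] \<open>\<eta> > 0\<close> u0(2) by (auto simp: A_def)
      \<comment> \<open>The time by which decay at the minimal rate would have used up all of the initial value.\<close>
      define t where "t = W (u 0) / D p"
      have "t \<ge> 0" using W(2)[OF u0(1)] \<open>D p > 0\<close> by (simp add: t_def)
      have "W (u t) \<le> W (u 0) + - D p * (t - 0)"
        using \<open>t \<ge> 0\<close> p uA by (intro decr) auto
      also have "\<dots> = 0" using \<open>D p > 0\<close> by (simp add: t_def)
      finally show False using ge[OF \<open>t \<ge> 0\<close>] \<open>\<eta> > 0\<close> by simp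
    qed
    show ?thesis
    proof (cases "?K = {}")
      case True
      then show ?thesis by (simp add: infdist_def)
    next
      case False
      show ?thesis
      proof (rule tendstoI)
        fix e :: real assume "e > 0"
        have "continuous_on S (\<lambda>p. infdist p ?K)" by (intro continuous_intros)
        then have "openin (top_of_set S) {p \<in> S. infdist p ?K < e}"
          by (rule openin_sublevel)
        moreover have "?K \<subseteq> {p \<in> S. infdist p ?K < e}" using \<open>e > 0\<close> by auto
        ultimately obtain \<delta> where \<delta>: "\<delta> > 0" "{p \<in> S. W p < \<delta>} \<subseteq> {p \<in> S. infdist p ?K < e}"
          using sublevel_inside_neighbourhood[OF S(1) W, of "{p \<in> S. infdist p ?K < e}"] by blast
        obtain s where s: "s \<ge> 0" "W (u s) < \<delta>" using reach[OF \<delta>(1)] by blast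
        have "dist (infdist (u t) ?K) 0 < e" if "t \<ge> s" for t
        proof -
          have "u t \<in> {p \<in> S. W p < \<delta>}" using mono[OF s(1) that] s inS that by auto
          then show ?thesis using \<delta>(2) by (auto simp: infdist_nonneg)
        qed
        then show "\<forall>\<^sub>F t in at_top. dist (infdist (u t) ?K) 0 < e"
          unfolding eventually_at_top_linorder by blast
      qed
    qed
  qed
  show ?thesis
    unfolding locally_attracting_on_def
    using pos(1) lim ex W(1) by (intro exI[of _ "{p \<in> S. W p < c}"] conjI openin_sublevel) auto
qed

text \<open>Invariance is required in both time directions, so monotonicity of \<open>W\<close> is not enough; the linear
  equation \<open>W' = r W\<close> with \<open>\<bar>r\<bar> \<le> B\<close> is what makes a zero propagate. Forward in time
  \<open>W exp (- B t)\<close> does not increase, and backward in time neither does \<open>W exp (B t)\<close>.\<close>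

lemma zero_set_invariant:
  fixes f :: "'a::real_normed_vector \<Rightarrow> 'a" and W :: "'a \<Rightarrow> real"
  assumes S: "compact S" "invariant_set f S"
    and W: "\<And>p. p \<in> S \<Longrightarrow> W p \<ge> 0"
    and r: "continuous_on S r"
    and der: "\<And>T u t. solution f T u \<Longrightarrow> t \<in> T \<Longrightarrow>
      ((\<lambda>s. W (u s)) has_real_derivative r (u t) * W (u t)) (at t within T)"
  shows "invariant_set f {p \<in> S. W p = 0}"
  unfolding invariant_set_def
proof (intro allI impI)
  fix T u assume *: "is_interval T \<and> 0 \<in> T \<and> solution f T u \<and> u 0 \<in> {p \<in> S. W p = 0}"
  then have T: "is_interval T" "0 \<in> T" and u: "solution f T u" and u0: "W (u 0) = 0" by auto
  have inS: "u t \<in> S" if "t \<in> T" for t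
    using S(2) * that unfolding invariant_set_def by blast
  have "bounded (r ` S)"
    using compact_continuous_image[OF r S(1)] by (rule compact_imp_bounded)
  then obtain B where B: "\<And>p. p \<in> S \<Longrightarrow> \<bar>r p\<bar> \<le> B"
    unfolding bounded_iff by auto
  \<comment> \<open>The factor \<open>c\<close> is 1 forward in time and -1 backward in time, to compare increments downwards.\<close>
  have der_exp: "((\<lambda>s. c * (W (u s) * exp (b * s))) has_real_derivative
      c * ((r (u t) + b) * W (u t) * exp (b * t))) (at t within T)" if "t \<in> T" for c b t
    by (rule derivative_eq_intros der[OF u that] refl)+ (simp add: algebra_simps)
  have "W (u t) \<le> 0" if t: "t \<in> T" for t
  proof (cases "t \<ge> 0")
    case True
    have "1 * (W (u t) * exp (- B * t)) \<le> 1 * (W (u 0) * exp (- B * 0)) + 0 * (t - 0)"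
    proof (rule increment_le_within[OF T(1,2) t True der_exp])
      fix \<tau> assume "\<tau> \<in> {0..t}"
      then have "\<tau> \<in> T" using T t mem_is_interval_1_I[of T 0 t \<tau>] by auto
      then show "1 * ((r (u \<tau>) + - B) * W (u \<tau>) * exp (- B * \<tau>)) \<le> 0"
        using B[OF inS, of \<tau>] W[OF inS, of \<tau>] by (auto intro!: mult_nonpos_nonneg)
    qed
    then show ?thesis using u0 by (simp add: mult_le_0_iff)
  next
    case False
    have "(- 1) * (W (u 0) * exp (B * 0)) \<le> (- 1) * (W (u t) * exp (B * t)) + 0 * (0 - t)"
    proof (rule increment_le_within[OF T(1) t T(2) _ der_exp])
      show "t \<le> 0" using False by simp
      fix \<tau> assume "\<tau> \<in> {t..0}"
      then have "\<tau> \<in> T" using T t mem_is_interval_1_I[of T t 0 \<tau>] by auto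
      then have "0 \<le> (r (u \<tau>) + B) * W (u \<tau>) * exp (B * \<tau>)"
        using B[OF inS, of \<tau>] W[OF inS, of \<tau>] by (intro mult_nonneg_nonneg) auto
      then show "(- 1) * ((r (u \<tau>) + B) * W (u \<tau>) * exp (B * \<tau>)) \<le> 0" by linarith
    qed
    then show ?thesis using u0 by (simp add: mult_le_0_iff)
  qed
  then show "u ` T \<subseteq> {p \<in> S. W p = 0}"
    using inS W by (force intro: order_antisym)
qed

section \<open>The Lyapunov function of the perturbed rattleback\<close>

definition spin_product :: "nat \<Rightarrow> R3 \<Rightarrow> real" where
  "spin_product l = (\<lambda>(x, y, z). x * y ^ l)"

text \<open>
  The factor in \<open>P' = - \<epsilon> P d\<close>, written as a power of \<open>y\<close> with even exponent times a sum of squares.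
\<close>

definition dissipation :: "nat \<Rightarrow> R3 \<Rightarrow> real" where
  "dissipation l = (\<lambda>(x, y, z).
     y ^ (2 * (l - 1)) * ((real l * x\<^sup>2 - y\<^sup>2)\<^sup>2 + z\<^sup>2 * (y\<^sup>2 + (real l)\<^sup>2 * x\<^sup>2)))"

text \<open>Facts about the rattleback are obtained from those about the perturbed system by setting \<open>\<epsilon> = 0\<close>.\<close>

lemma p_het_0: "p_het l 0 = rattleback l"
  by (auto simp: fun_eq_iff p_het_def rattleback_def)

lemma p_het_orthogonal: "p_het l \<epsilon> p \<bullet> p = 0"
  by (cases p) (simp add: p_het_def rattleback_def algebra_simps power2_eq_square)

lemma norm_R3: "(norm (x, y, z :: real))\<^sup>2 = x\<^sup>2 + y\<^sup>2 + z\<^sup>2"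
  by (simp add: norm_Pair)

lemma Casimir_level: "Casimir -` {M\<^sup>2 / 2} = sphere 0 \<bar>M\<bar>"
proof -
  have "Casimir p = M\<^sup>2 / 2 \<longleftrightarrow> norm p = \<bar>M\<bar>" for p
  proof -
    have "Casimir p = (norm p)\<^sup>2 / 2"
      by (cases p) (simp add: Casimir_def norm_R3)
    then show ?thesis using power2_eq_iff_nonneg[of "norm p" "\<bar>M\<bar>"] by simp
  qed
  then show ?thesis by auto
qed

lemma energy_Casimir_level:
  "energy_Casimir l -` {(0, M\<^sup>2 / 2)} = {p \<in> sphere 0 \<bar>M\<bar>. (spin_product l p)\<^sup>2 = 0}"
proof -
  have "energy_Casimir l p = (spin_product l p, Casimir p)" for p
    by (cases p) (simp add: energy_Casimir_def spin_product_def)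
  then show ?thesis
    unfolding Casimir_level[symmetric] by (simp add: set_eq_iff conj_commute)
qed

lemma p_het_invariant_sphere: "invariant_set (p_het l \<epsilon>) (sphere 0 r)"
  unfolding invariant_set_def
proof (intro allI impI image_subsetI)
  fix T u t
  assume "is_interval T \<and> 0 \<in> T \<and> solution (p_het l \<epsilon>) T u \<and> u 0 \<in> sphere 0 r" "t \<in> T"
  then show "u t \<in> sphere 0 r"
    using orthogonal_solution_norm_constant[of "p_het l \<epsilon>" T u t 0] p_het_orthogonal by simp
qed

lemma solution_coordinates:
  fixes u :: "real \<Rightarrow> R3"
  assumes "solution f T u" "t \<in> T" "f (u t) = (a, b, c)"
  shows "((\<lambda>t. fst (u t)) has_real_derivative a) (at t within T)"
    and "((\<lambda>t. fst (snd (u t))) has_real_derivative b) (at t within T)"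
    and "((\<lambda>t. snd (snd (u t))) has_real_derivative c) (at t within T)"
proof -
  have u: "(u has_vector_derivative (a, b, c)) (at t within T)"
    using assms by (force simp: solution_def)
  note snd_u = bounded_linear.has_vector_derivative[OF bounded_linear_snd u]
  show "((\<lambda>t. fst (u t)) has_real_derivative a) (at t within T)"
    using bounded_linear.has_vector_derivative[OF bounded_linear_fst u]
    by (simp add: has_real_derivative_iff_has_vector_derivative)
  show "((\<lambda>t. fst (snd (u t))) has_real_derivative b) (at t within T)"
    using bounded_linear.has_vector_derivative[OF bounded_linear_fst snd_u]
    by (simp add: has_real_derivative_iff_has_vector_derivative)
  show "((\<lambda>t. snd (snd (u t))) has_real_derivative c) (at t within T)"
    using bounded_linear.has_vector_derivative[OF bounded_linear_snd snd_u]
    by (simp add: has_real_derivative_iff_has_vector_derivative)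
qed

text \<open>The unperturbed part contributes nothing. With \<open>Y = y\<^bsup>l-1\<^esup>\<close> the perturbation contributes to
  \<open>P'\<close> the product of \<open>\<epsilon> x y Y\<^sup>3\<close> and
  \<open>y\<^sup>2 (l x\<^sup>2 - y\<^sup>2 - z\<^sup>2) + l x\<^sup>2 (- l x\<^sup>2 + y\<^sup>2 - l z\<^sup>2) = - (l x\<^sup>2 - y\<^sup>2)\<^sup>2 - z\<^sup>2 (y\<^sup>2 + l\<^sup>2 x\<^sup>2)\<close>.
  The square of \<open>P\<close> is used instead of \<open>P\<close> to have a nonnegative function with the same zeros.\<close>

lemma spin_product_square_derivative:
  assumes "l > 0" "solution (p_het l \<epsilon>) T u" "t \<in> T"
  shows "((\<lambda>s. (spin_product l (u s))\<^sup>2) has_real_derivative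
    - (2 * \<epsilon> * dissipation l (u t)) * (spin_product l (u t))\<^sup>2) (at t within T)"
proof -
  obtain k where l: "l = Suc k" using assms(1) gr0_implies_Suc by blast
  obtain x y z where p: "u t = (x, y, z)" by (cases "u t")
  define Y where "Y = y ^ k"
  define L where "L = real l"
  have pow: "y ^ (2 * l - 1) = y * Y\<^sup>2" "y ^ (2 * (l - 1)) = Y\<^sup>2" "y ^ l = y * Y"
    by (simp_all add: l Y_def power2_eq_square flip: power_add mult_2)
  then have pow1: "y ^ (2 * l - Suc 0) = y * Y\<^sup>2" by simp
  obtain a b c where abc: "p_het l \<epsilon> (u t) = (a, b, c)" by (cases "p_het l \<epsilon> (u t)")
  then have a: "a = L * x * z + \<epsilon> * x * (y * Y\<^sup>2) * (y * (L * x\<^sup>2 - y\<^sup>2 - z\<^sup>2))"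
    and b: "b = - y * z + \<epsilon> * x * (y * Y\<^sup>2) * (x * (- L * x\<^sup>2 + y\<^sup>2 - L * z\<^sup>2))"
    by (auto simp: p p_het_def rattleback_def pow1 L_def)
  note der = solution_coordinates[OF assms(2,3) abc]
  have "((\<lambda>s. (fst (u s) * fst (snd (u s)) ^ l)\<^sup>2) has_real_derivative
      2 * (x * (y * Y)) * (a * (y * Y) + x * (L * Y * b))) (at t within T)"
    by (rule derivative_eq_intros der refl)+
      (simp add: p l Y_def L_def power2_eq_square algebra_simps)
  also have "2 * (x * (y * Y)) * (a * (y * Y) + x * (L * Y * b))
      = - (2 * \<epsilon> * (Y\<^sup>2 * ((L * x\<^sup>2 - y\<^sup>2)\<^sup>2 + z\<^sup>2 * (y\<^sup>2 + L\<^sup>2 * x\<^sup>2)))) * (x * (y * Y))\<^sup>2"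
    unfolding a b by algebra
  finally show ?thesis
    unfolding spin_product_def dissipation_def p L_def case_prod_unfold fst_conv snd_conv pow .
qed

lemma dissipation_nonneg: "dissipation l p \<ge> 0"
  by (cases p) (simp add: dissipation_def)

lemma continuous_on_spin_product: "continuous_on A (spin_product l)"
  unfolding spin_product_def case_prod_unfold by (intro continuous_intros)

lemma continuous_on_dissipation: "continuous_on A (dissipation l)"
  unfolding dissipation_def case_prod_unfold by (intro continuous_intros)

text \<open>If the dissipation vanishes although \<open>x\<close> and \<open>y\<close> do not, then \<open>z = 0\<close> and \<open>y\<^sup>2 = l x\<^sup>2\<close>. On the
  sphere this gives \<open>x\<^sup>2 = M\<^sup>2 / (1 + l)\<close>, and the value of \<open>P\<^sup>2 = x\<^sup>2 (y\<^sup>2)\<^sup>l\<close> is then the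
  bound in the hypothesis.\<close>

lemma dissipation_pos:
  assumes "l > 0" "norm p = \<bar>M\<bar>" "spin_product l p \<noteq> 0"
    and less: "(spin_product l p)\<^sup>2 < M\<^sup>2 / (1 + real l) * (real l * M\<^sup>2 / (1 + real l)) ^ l"
  shows "dissipation l p > 0"
proof (rule ccontr)
  assume "\<not> ?thesis"
  then have 0: "dissipation l p = 0" using dissipation_nonneg[of l p] by simp
  obtain x y z where p: "p = (x, y, z)" by (cases p)
  have "x \<noteq> 0" "y \<noteq> 0"
    using assms(1,3) by (auto simp: p spin_product_def)
  have "(real l * x\<^sup>2 - y\<^sup>2)\<^sup>2 + z\<^sup>2 * (y\<^sup>2 + (real l)\<^sup>2 * x\<^sup>2) = 0"
    using 0 \<open>y \<noteq> 0\<close> by (simp add: p dissipation_def)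
  moreover have "(real l * x\<^sup>2 - y\<^sup>2)\<^sup>2 \<ge> 0" "z\<^sup>2 * (y\<^sup>2 + (real l)\<^sup>2 * x\<^sup>2) \<ge> 0" by simp_all
  ultimately have "(real l * x\<^sup>2 - y\<^sup>2)\<^sup>2 = 0" "z\<^sup>2 * (y\<^sup>2 + (real l)\<^sup>2 * x\<^sup>2) = 0"
    by linarith+
  moreover have "y\<^sup>2 + (real l)\<^sup>2 * x\<^sup>2 > 0"
    using \<open>y \<noteq> 0\<close> by (intro add_pos_nonneg) auto
  ultimately have y2: "y\<^sup>2 = real l * x\<^sup>2" and "z = 0" by auto
  have "x\<^sup>2 + y\<^sup>2 + z\<^sup>2 = M\<^sup>2"
    using norm_R3[of x y z] assms(2) by (simp add: p)
  then have "x\<^sup>2 * (1 + real l) = M\<^sup>2" using y2 \<open>z = 0\<close> by (simp add: algebra_simps)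
  then have x2: "x\<^sup>2 = M\<^sup>2 / (1 + real l)" by (simp add: field_simps)
  have "(spin_product l p)\<^sup>2 = x\<^sup>2 * (y\<^sup>2) ^ l"
    by (simp add: p spin_product_def power_mult_distrib flip: power_mult) (simp add: mult.commute)
  then show False using less unfolding y2 x2 by simp
qed

section \<open>The heteroclinic cycles of the rattleback\<close>

text \<open>The circle of radius \<open>m\<close> without its two points on the \<open>w\<close>-axis consists of two arcs, told apart
  by the sign \<open>\<sigma>\<close> of \<open>v\<close>.\<close>

lemma tanh_cosh_parametrization:
  fixes v w m :: real
  assumes "m > 0" "v\<^sup>2 + w\<^sup>2 = m\<^sup>2" "v \<noteq> 0"
  obtains \<sigma> t where "\<sigma>\<^sup>2 = 1" "v = \<sigma> * m / cosh t" "w = m * tanh t"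
proof -
  have "w\<^sup>2 < m\<^sup>2" using assms(2,3) by (smt (verit) zero_less_power2)
  then have "\<bar>w\<bar> < m" using assms(1) abs_le_square_iff[of m w] by simp
  define q where "q = w / m"
  have q: "-1 < q" "q < 1" using \<open>\<bar>w\<bar> < m\<close> assms(1) by (auto simp: q_def field_simps)
  define t where "t = ln (sqrt ((1 + q) / (1 - q)))"
  have "tanh t = q"
    using q by (simp add: t_def tanh_ln_real real_sqrt_gt_zero divide_simps)
  then have w: "w = m * tanh t" using assms(1) by (simp add: q_def)
  have c: "cosh t > 0" by simp
  define \<sigma> where "\<sigma> = v * cosh t / m"
  have "(cosh t)\<^sup>2 * v\<^sup>2 = (cosh t)\<^sup>2 * m\<^sup>2 - m\<^sup>2 * (cosh t * tanh t)\<^sup>2"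
    using assms(2) unfolding w by algebra
  also have "cosh t * tanh t = sinh t" using c by (simp add: tanh_def)
  also have "(cosh t)\<^sup>2 * m\<^sup>2 - m\<^sup>2 * (sinh t)\<^sup>2 = m\<^sup>2"
    using cosh_square_eq[of t] by algebra
  finally have "\<sigma>\<^sup>2 = 1" using assms(1) by (simp add: \<sigma>_def power_divide power_mult_distrib mult.commute)
  moreover have "v = \<sigma> * m / cosh t" using c assms(1) by (simp add: \<sigma>_def)
  ultimately show thesis using w that by blast
qed

lemma filterlim_scale_at_top_at_bot:
  fixes k :: real
  assumes "k > 0"
  shows "filterlim (\<lambda>t. k * t) at_top at_top" "filterlim (\<lambda>t. k * t) at_bot at_bot"
  using assms
  by (auto intro: filterlim_tendsto_pos_mult_at_top filterlim_tendsto_pos_mult_at_bot tendsto_const filterlim_ident)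

lemma tanh_scaled_limits:
  fixes k :: real
  assumes "k > 0"
  shows "((\<lambda>t. tanh (k * t)) \<longlongrightarrow> 1) at_top" "((\<lambda>t. tanh (k * t)) \<longlongrightarrow> -1) at_bot"
  by (rule filterlim_compose[OF tanh_real_at_top filterlim_scale_at_top_at_bot(1)[OF assms]]
      filterlim_compose[OF tanh_real_at_bot filterlim_scale_at_top_at_bot(2)[OF assms]])+

lemma sech_scaled_limits:
  fixes k c :: real
  assumes "k > 0"
  shows "((\<lambda>t. c / cosh (k * t)) \<longlongrightarrow> 0) at_top" "((\<lambda>t. c / cosh (k * t)) \<longlongrightarrow> 0) at_bot"
  using filterlim_compose[OF cosh_real_at_top filterlim_scale_at_top_at_bot(1)[OF assms]]
    filterlim_compose[OF cosh_real_at_bot filterlim_scale_at_top_at_bot(2)[OF assms]]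
  by (auto intro!: tendsto_divide_0[OF tendsto_const] filterlim_at_top_imp_at_infinity)

lemma has_vector_derivative_R3:
  fixes u1 u2 u3 :: "real \<Rightarrow> real"
  assumes "(u1 has_real_derivative a) (at t)" "(u2 has_real_derivative b) (at t)"
    "(u3 has_real_derivative c) (at t)"
  shows "((\<lambda>t. (u1 t, u2 t, u3 t)) has_vector_derivative (a, b, c)) (at t)"
proof -
  have "((\<lambda>t. (u1 t, u2 t, u3 t)) has_derivative (\<lambda>h. (a * h, b * h, c * h))) (at t)"
    using assms unfolding has_field_derivative_def by (intro has_derivative_Pair)
  then show ?thesis
    unfolding has_vector_derivative_def by (rule has_derivative_eq_rhs) (simp add: mult.commute)
qed

lemma sech_square:
  fixes c s :: real
  shows "(c / cosh s)\<^sup>2 = c\<^sup>2 * (1 - (tanh s)\<^sup>2)"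
proof -
  have "cosh s \<noteq> 0" by simp
  then have "1 - (tanh s)\<^sup>2 = ((cosh s)\<^sup>2 - (sinh s)\<^sup>2) / (cosh s)\<^sup>2"
    by (simp add: tanh_def power_divide diff_divide_distrib)
  also have "\<dots> = 1 / (cosh s)\<^sup>2" using cosh_square_eq[of s] by simp
  finally show ?thesis by (simp add: power_divide)
qed

lemma rattleback_e3: "rattleback l (e3 m) = 0"
  by (simp add: rattleback_def e3_def zero_prod_def)

text \<open>In the plane \<open>x = 0\<close> the system reads \<open>y' = - y z\<close>, \<open>z' = y\<^sup>2\<close>, so motion is from the south
  pole to the north pole.\<close>

lemma heteroclinic_orbit_x_zero:
  assumes "m > 0" "\<sigma>\<^sup>2 = 1"
  shows "range (\<lambda>t. (0, \<sigma> * m / cosh (m * t), m * tanh (m * t)))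
    \<in> heteroclinic_orbits (rattleback l) (- e3 m) (e3 m)" (is "range ?u \<in> _")
proof -
  have "(?u has_vector_derivative rattleback l (?u t)) (at t)" for t
  proof -
    have c: "cosh (m * t) \<noteq> 0" by simp
    have "(\<sigma> * m / cosh (m * t))\<^sup>2 = m\<^sup>2 * (1 - (tanh (m * t))\<^sup>2)"
      using assms(2) by (simp add: sech_square power_mult_distrib)
    then have "rattleback l (?u t)
        = (0, - (\<sigma> * m / cosh (m * t)) * (m * tanh (m * t)), m\<^sup>2 * (1 - (tanh (m * t))\<^sup>2))"
      by (simp add: rattleback_def)
    moreover have "((\<lambda>t. \<sigma> * m / cosh (m * t)) has_real_derivative
        - (\<sigma> * m / cosh (m * t)) * (m * tanh (m * t))) (at t)"
      using c by (auto intro!: derivative_eq_intros simp: tanh_def field_simps)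
    moreover have "((\<lambda>t. m * tanh (m * t)) has_real_derivative m\<^sup>2 * (1 - (tanh (m * t))\<^sup>2)) (at t)"
      using c by (auto intro!: derivative_eq_intros simp: power2_eq_square)
    ultimately show ?thesis by (simp add: has_vector_derivative_R3)
  qed
  moreover have "(?u \<longlongrightarrow> (0, 0, m * (-1))) at_bot" "(?u \<longlongrightarrow> (0, 0, m * 1)) at_top"
    by (intro tendsto_Pair tendsto_mult tendsto_const
        tanh_scaled_limits[OF assms(1)] sech_scaled_limits[OF assms(1)])+
  ultimately show ?thesis
    using assms(1) rattleback_e3[of l m] rattleback_e3[of l "- m"]
    by (auto simp: heteroclinic_orbits_def solution_def e3_def)
qed

text \<open>In the plane \<open>y = 0\<close> the system reads \<open>x' = l x z\<close>, \<open>z' = - l x\<^sup>2\<close>, so motion is from the north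
  pole to the south pole, \<open>l\<close> times as fast.\<close>

lemma heteroclinic_orbit_y_zero:
  assumes "m > 0" "\<sigma>\<^sup>2 = 1" "l > 0"
  shows "range (\<lambda>t. (\<sigma> * m / cosh (real l * m * t), 0, - m * tanh (real l * m * t)))
    \<in> heteroclinic_orbits (rattleback l) (e3 m) (- e3 m)" (is "range ?u \<in> _")
proof -
  define k where "k = real l * m"
  have "k > 0" using assms by (simp add: k_def)
  have "(?u has_vector_derivative rattleback l (?u t)) (at t)" for t
  proof -
    have c: "cosh (k * t) \<noteq> 0" by simp
    have "(\<sigma> * m / cosh (k * t))\<^sup>2 = m\<^sup>2 * (1 - (tanh (k * t))\<^sup>2)"
      using assms(2) by (simp add: sech_square power_mult_distrib)
    then have "rattleback l (?u t)
        = (- (\<sigma> * m / cosh (k * t)) * (k * tanh (k * t)), 0, - m * (k * (1 - (tanh (k * t))\<^sup>2)))"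
      by (simp add: rattleback_def k_def[symmetric]) (simp add: k_def power2_eq_square)
    moreover have "((\<lambda>t. \<sigma> * m / cosh (k * t)) has_real_derivative
        - (\<sigma> * m / cosh (k * t)) * (k * tanh (k * t))) (at t)"
      using c by (auto intro!: derivative_eq_intros simp: tanh_def field_simps)
    moreover have "((\<lambda>t. - m * tanh (k * t)) has_real_derivative - m * (k * (1 - (tanh (k * t))\<^sup>2))) (at t)"
      using c by (auto intro!: derivative_eq_intros)
    ultimately show ?thesis by (simp add: has_vector_derivative_R3 k_def)
  qed
  moreover have "(?u \<longlongrightarrow> (0, 0, - m * (-1))) at_bot" "(?u \<longlongrightarrow> (0, 0, - m * 1)) at_top"
    unfolding k_def[symmetric]
    by (intro tendsto_Pair tendsto_mult tendsto_const
        tanh_scaled_limits[OF \<open>k > 0\<close>] sech_scaled_limits[OF \<open>k > 0\<close>])+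
  ultimately show ?thesis
    using assms(1) rattleback_e3[of l m] rattleback_e3[of l "- m"]
    by (auto simp: heteroclinic_orbits_def solution_def e3_def)
qed

text \<open>The norm and \<open>P\<^sup>2\<close> are first integrals, hence constant along the orbit and equal to their
  values at the limit point \<open>(0, 0, z0)\<close>.\<close>

lemma rattleback_orbit_spin_product_zero:
  assumes "l > 0" "X \<in> heteroclinic_orbits (rattleback l) (e3 z0) q"
  shows "X \<subseteq> {p \<in> sphere 0 \<bar>z0\<bar>. (spin_product l p)\<^sup>2 = 0}"
proof -
  obtain u where X: "X = range u" and u: "solution (rattleback l) UNIV u"
    and lim: "(u \<longlongrightarrow> e3 z0) at_bot"
    by (rule heteroclinic_orbitE[OF assms(2)])
  have constant_eq_limit: "g (u t) = g (e3 z0)"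
    if const: "\<And>s t. g (u s) = g (u t)" and "continuous_on UNIV g" for g :: "R3 \<Rightarrow> real" and t
  proof -
    have 1: "((\<lambda>s. g (u s)) \<longlongrightarrow> g (e3 z0)) at_bot"
      using continuous_on_tendsto_compose[OF \<open>continuous_on UNIV g\<close> lim] by simp
    moreover have "(\<lambda>s. g (u s)) = (\<lambda>_. g (u t))" using const[of _ t] by (rule ext)
    ultimately show ?thesis by (simp add: tendsto_const_iff)
  qed
  have "norm (u t) = norm (e3 z0)" for t
    using orthogonal_solution_norm_constant[OF u[folded p_het_0] is_interval_univ p_het_orthogonal]
    by (intro constant_eq_limit continuous_intros) auto
  moreover have "norm (e3 z0) = \<bar>z0\<bar>" by (simp add: e3_def norm_Pair)
  moreover have "(spin_product l (u t))\<^sup>2 = (spin_product l (e3 z0))\<^sup>2" for t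
  proof (rule constant_eq_limit)
    obtain c where "\<forall>t\<in>UNIV. (spin_product l (u t))\<^sup>2 = c"
      using has_field_derivative_zero_constant[of UNIV "\<lambda>t. (spin_product l (u t))\<^sup>2"]
        spin_product_square_derivative[OF assms(1) u[folded p_het_0]] by auto
    then show "(spin_product l (u s))\<^sup>2 = (spin_product l (u t))\<^sup>2" for s t by simp
    show "continuous_on UNIV (\<lambda>p. (spin_product l p)\<^sup>2)"
      by (intro continuous_intros continuous_on_spin_product)
  qed
  moreover have "spin_product l (e3 z0) = 0" by (simp add: e3_def spin_product_def)
  ultimately show ?thesis by (auto simp: X)
qed

lemma heteroclinic_cycles_eq:
  assumes "l > 0" "m > 0"
  shows "heteroclinic_cycles (rattleback l) (- e3 m) (e3 m) = {p \<in> sphere 0 m. (spin_product l p)\<^sup>2 = 0}"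
    (is "?H = ?K")
proof
  have neg: "- e3 m = e3 (- m)" by (simp add: e3_def)
  have ends: "e3 z0 \<in> ?K" if "\<bar>z0\<bar> = m" for z0
    using that assms by (simp add: e3_def norm_Pair spin_product_def)
  have orbits: "X \<subseteq> ?K" if "X \<in> heteroclinic_orbits (rattleback l) (e3 z0) q" "\<bar>z0\<bar> = m" for X z0 q
    using rattleback_orbit_spin_product_zero[OF assms(1) that(1)] that(2) by simp
  have abs: "\<bar>m\<bar> = m" "\<bar>- m\<bar> = m" using assms(2) by auto
  show "?H \<subseteq> ?K"
    unfolding heteroclinic_cycles_def neg
  proof (intro Un_least Union_least)
    show "{e3 (- m), e3 m} \<subseteq> ?K" using ends[OF abs(1)] ends[OF abs(2)] by blast
    fix X assume "X \<in> heteroclinic_orbits (rattleback l) (e3 (- m)) (e3 m)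
      \<union> heteroclinic_orbits (rattleback l) (e3 m) (e3 (- m))"
    then show "X \<subseteq> ?K" using orbits[OF _ abs(1)] orbits[OF _ abs(2)] by blast
  qed
  show "?K \<subseteq> ?H"
  proof
    fix p assume pK: "p \<in> ?K"
    obtain x y z where p: "p = (x, y, z)" by (cases p)
    have sq: "x\<^sup>2 + y\<^sup>2 + z\<^sup>2 = m\<^sup>2" using pK norm_R3[of x y z] by (simp add: p)
    have "x = 0 \<or> y = 0" using pK by (auto simp: p spin_product_def)
    then consider (eq) "x = 0" "y = 0" | (x0) "x = 0" "y \<noteq> 0" | (y0) "y = 0" "x \<noteq> 0" by blast
    then show "p \<in> ?H"
    proof cases
      case eq
      then have "z = m \<or> z = - m" using sq by (simp add: power2_eq_iff)
      then show ?thesis using eq by (auto simp: p heteroclinic_cycles_def e3_def)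
    next
      case x0
      then obtain \<sigma> t where \<sigma>: "\<sigma>\<^sup>2 = 1" and yz: "y = \<sigma> * m / cosh t" "z = m * tanh t"
        using tanh_cosh_parametrization[OF assms(2), of y z] sq by auto
      have "p \<in> range (\<lambda>t. (0, \<sigma> * m / cosh (m * t), m * tanh (m * t)))"
        using assms(2) x0 yz by (intro image_eqI[of _ _ "t / m"]) (auto simp: p)
      then show ?thesis
        using heteroclinic_orbit_x_zero[OF assms(2) \<sigma>, of l] unfolding heteroclinic_cycles_def by blast
    next
      case y0
      then obtain \<sigma> t where \<sigma>: "\<sigma>\<^sup>2 = 1" and xz: "x = \<sigma> * m / cosh t" "- z = m * tanh t"
        using tanh_cosh_parametrization[OF assms(2), of x "- z"] sq by auto
      have "p \<in> range (\<lambda>t. (\<sigma> * m / cosh (real l * m * t), 0, - m * tanh (real l * m * t)))"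
        using assms y0 xz by (intro image_eqI[of _ _ "t / (real l * m)"]) (auto simp: p)
      then show ?thesis
        using heteroclinic_orbit_y_zero[OF assms(2) \<sigma> assms(1)] unfolding heteroclinic_cycles_def by blast
    qed
  qed
qed

lemma p_het_eq_rattleback:
  assumes "l > 0" "spin_product l p = 0"
  shows "p_het l \<epsilon> p = rattleback l p"
  using assms by (cases p) (auto simp: spin_product_def p_het_def zero_prod_def)

text \<open>These orbits lie in the zero set of \<open>P\<close>, where the two vector fields coincide.\<close>

lemma rattleback_orbits_are_p_het_orbits:
  assumes "l > 0"
  shows "heteroclinic_orbits (rattleback l) (e3 z0) (e3 z1) \<subseteq> heteroclinic_orbits (p_het l \<epsilon>) (e3 z0) (e3 z1)"
proof
  fix X assume X: "X \<in> heteroclinic_orbits (rattleback l) (e3 z0) (e3 z1)"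
  have e3: "p_het l \<epsilon> (e3 z) = rattleback l (e3 z)" for z
    using assms by (intro p_het_eq_rattleback) (auto simp: e3_def spin_product_def)
  have "spin_product l p = 0" if "p \<in> X" for p
    using rattleback_orbit_spin_product_zero[OF assms X] that by auto
  then have "p_het l \<epsilon> p = rattleback l p" if "p \<in> X" for p
    using p_het_eq_rattleback[OF assms] that by blast
  then have "solution (p_het l \<epsilon>) UNIV u" if "solution (rattleback l) UNIV u" "X = range u" for u
    using that by (simp add: solution_def)
  then show "X \<in> heteroclinic_orbits (p_het l \<epsilon>) (e3 z0) (e3 z1)"
    using X unfolding heteroclinic_orbits_def e3 by blast
qed

section \<open>Global existence for the perturbed rattleback\<close>

text \<open>
  A class of functions that contains all polynomials: unlike the globally Lipschitz functions it is
  closed under products, and the Lipschitz constant may depend on the ball.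
\<close>

definition lipschitz_on_balls :: "('a::real_normed_vector \<Rightarrow> 'b::real_normed_vector) \<Rightarrow> bool" where
  "lipschitz_on_balls f \<longleftrightarrow> (\<forall>R. \<exists>L. L-lipschitz_on (cball 0 R) f)"

lemma lipschitz_on_balls_const: "lipschitz_on_balls (\<lambda>_. c)"
  unfolding lipschitz_on_balls_def by (blast intro: lipschitz_on_constant)

lemma lipschitz_on_balls_linear: "bounded_linear f \<Longrightarrow> lipschitz_on_balls f"
  unfolding lipschitz_on_balls_def by (metis bounded_linear.lipschitz_boundE)

lemma lipschitz_on_balls_add:
  "lipschitz_on_balls f \<Longrightarrow> lipschitz_on_balls g \<Longrightarrow> lipschitz_on_balls (\<lambda>p. f p + g p)"
  unfolding lipschitz_on_balls_def by (blast intro: lipschitz_on_add)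

lemma lipschitz_on_balls_diff:
  "lipschitz_on_balls f \<Longrightarrow> lipschitz_on_balls g \<Longrightarrow> lipschitz_on_balls (\<lambda>p. f p - g p)"
  unfolding lipschitz_on_balls_def by (blast intro: lipschitz_on_diff)

lemma lipschitz_on_balls_Pair:
  "lipschitz_on_balls f \<Longrightarrow> lipschitz_on_balls g \<Longrightarrow> lipschitz_on_balls (\<lambda>p. (f p, g p))"
  unfolding lipschitz_on_balls_def by (blast intro: lipschitz_on_Pair)

lemma lipschitz_on_balls_bounded:
  assumes "lipschitz_on_balls f"
  shows "\<exists>B\<ge>0. \<forall>p\<in>cball 0 R. norm (f p) \<le> B"
proof -
  obtain L where L: "L-lipschitz_on (cball 0 R) f" using assms unfolding lipschitz_on_balls_def by blast
  have "norm (f p) \<le> norm (f 0) + L * \<bar>R\<bar>" if "p \<in> cball 0 R" for p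
  proof -
    have "norm p \<le> R" using that by simp
    then have "R \<ge> 0" using norm_ge_zero order_trans by blast
    then have "norm (f p - f 0) \<le> L * norm p"
      using lipschitz_on_normD[OF L that, of 0] by simp
    also have "\<dots> \<le> L * \<bar>R\<bar>"
      using \<open>norm p \<le> R\<close> lipschitz_on_nonneg[OF L] by (intro mult_left_mono) auto
    finally show ?thesis using norm_triangle_ineq2[of "f p" "f 0"] by linarith
  qed
  moreover have "norm (f 0) + L * \<bar>R\<bar> \<ge> 0" using lipschitz_on_nonneg[OF L] by simp
  ultimately show ?thesis by blast
qed

lemma lipschitz_on_balls_mult:
  fixes f g :: "'a::real_normed_vector \<Rightarrow> real"
  assumes "lipschitz_on_balls f" "lipschitz_on_balls g"
  shows "lipschitz_on_balls (\<lambda>p. f p * g p)"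
  unfolding lipschitz_on_balls_def
proof
  fix R
  obtain L where L: "L-lipschitz_on (cball 0 R) f" using assms(1) unfolding lipschitz_on_balls_def by blast
  obtain K where K: "K-lipschitz_on (cball 0 R) g" using assms(2) unfolding lipschitz_on_balls_def by blast
  obtain A where A: "A \<ge> 0" "\<And>p. p \<in> cball 0 R \<Longrightarrow> norm (f p) \<le> A"
    using lipschitz_on_balls_bounded[OF assms(1), of R] by blast
  obtain B where B: "B \<ge> 0" "\<And>p. p \<in> cball 0 R \<Longrightarrow> norm (g p) \<le> B"
    using lipschitz_on_balls_bounded[OF assms(2), of R] by blast
  have "(A * K + L * B)-lipschitz_on (cball 0 R) (\<lambda>p. f p * g p)"
  proof (rule lipschitz_onI)
    fix p q :: 'a assume pq: "p \<in> cball 0 R" "q \<in> cball 0 R"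
    have "f p * g p - f q * g q = f p * (g p - g q) + (f p - f q) * g q"
      by (simp add: algebra_simps)
    then have "dist (f p * g p) (f q * g q) \<le> norm (f p) * norm (g p - g q) + norm (f p - f q) * norm (g q)"
      by (metis dist_norm norm_mult norm_triangle_ineq)
    also have "\<dots> \<le> A * (K * norm (p - q)) + (L * norm (p - q)) * B"
      using pq A B lipschitz_on_normD[OF L pq] lipschitz_on_normD[OF K pq]
        lipschitz_on_nonneg[OF L]
      by (intro add_mono mult_mono) auto
    finally show "dist (f p * g p) (f q * g q) \<le> (A * K + L * B) * dist p q"
      by (simp add: dist_norm algebra_simps)
  qed (use A B lipschitz_on_nonneg[OF L] lipschitz_on_nonneg[OF K] in auto)
  then show "\<exists>L. L-lipschitz_on (cball 0 R) (\<lambda>p. f p * g p)" by blast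
qed

lemma lipschitz_on_balls_power:
  fixes f :: "'a::real_normed_vector \<Rightarrow> real"
  assumes "lipschitz_on_balls f"
  shows "lipschitz_on_balls (\<lambda>p. f p ^ n)"
  by (induction n) (auto intro: lipschitz_on_balls_const lipschitz_on_balls_mult assms)

lemma p_het_lipschitz_on_balls: "lipschitz_on_balls (p_het l \<epsilon>)"
proof -
  have "p_het l \<epsilon> = (\<lambda>p. let x = fst p; y = fst (snd p); z = snd (snd p); c = \<epsilon> * x * y ^ (2 * l - 1) in
      (real l * x * z + c * (y * (real l * x\<^sup>2 - y\<^sup>2 - z\<^sup>2)),
       0 - y * z + c * (x * (y\<^sup>2 - real l * x\<^sup>2 - real l * z\<^sup>2)),
       y\<^sup>2 - real l * x\<^sup>2 + c * ((real l + 1) * x * y * z)))"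
    by (auto simp: fun_eq_iff p_het_def rattleback_def Let_def)
  moreover have "lipschitz_on_balls \<dots>"
    unfolding Let_def
    by (intro lipschitz_on_balls_Pair lipschitz_on_balls_add lipschitz_on_balls_diff
        lipschitz_on_balls_mult lipschitz_on_balls_power lipschitz_on_balls_const
        lipschitz_on_balls_linear bounded_linear_intros)
  ultimately show ?thesis by simp
qed

lemma p_het_global_solution: "\<exists>u. solution (p_het l \<epsilon>) {0..} u \<and> u 0 = a"
proof -
  have "\<exists>L. L-lipschitz_on (cball 0 R) (p_het l \<epsilon>)" for R
    using p_het_lipschitz_on_balls unfolding lipschitz_on_balls_def by blast
  then obtain u where "solution (p_het l \<epsilon>) {0..} u" "u 0 = a"
    by (rule orthogonal_field_global_solution[OF _ p_het_orthogonal])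
  then show ?thesis by blast
qed

section \<open>Asymptotic stabilization\<close>

theorem theorem9p4:
  fixes l :: nat and \<epsilon> M :: real
  assumes "l > 1" and "\<epsilon> > 0" and "M \<noteq> 0"
  shows "asymptotically_stabilizes_cycles (rattleback l) (p_het l \<epsilon>)
           (- e3 \<bar>M\<bar>) (e3 \<bar>M\<bar>)
           (energy_Casimir l -` {(0, M\<^sup>2 / 2)})
           (Casimir -` {M\<^sup>2 / 2})"
proof -
  define m where "m = \<bar>M\<bar>"
  define S where "S = sphere (0::R3) m"
  define W where "W p = (spin_product l p)\<^sup>2" for p
  define r where "r p = - (2 * \<epsilon> * dissipation l p)" for p
  \<comment> \<open>The value of \<open>P\<^sup>2\<close> at the points with \<open>z = 0\<close> and \<open>y\<^sup>2 = l x\<^sup>2\<close>.\<close>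
  define c where "c = M\<^sup>2 / (1 + real l) * (real l * M\<^sup>2 / (1 + real l)) ^ l"
  have l: "l > 0" and m: "m > 0" using assms by (auto simp: m_def)
  have neg: "- e3 m = e3 (- m)" by (simp add: e3_def)
  have orbits_subset:
    "heteroclinic_orbits (rattleback l) (- e3 m) (e3 m) \<subseteq> heteroclinic_orbits (p_het l \<epsilon>) (- e3 m) (e3 m)"
    "heteroclinic_orbits (rattleback l) (e3 m) (- e3 m) \<subseteq> heteroclinic_orbits (p_het l \<epsilon>) (e3 m) (- e3 m)"
    unfolding neg by (rule rattleback_orbits_are_p_het_orbits[OF l])+
  have nonempty: "heteroclinic_orbits (rattleback l) (- e3 m) (e3 m) \<noteq> {}"
    "heteroclinic_orbits (rattleback l) (e3 m) (- e3 m) \<noteq> {}"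
    using heteroclinic_orbit_x_zero[OF m, of 1 l] heteroclinic_orbit_y_zero[OF m _ l, of 1] by auto
  have S: "compact S" "invariant_set (p_het l \<epsilon>) S"
    unfolding S_def by (simp_all add: p_het_invariant_sphere)
  have W: "continuous_on S W" "\<And>p. W p \<ge> 0"
    unfolding W_def by (auto intro!: continuous_intros continuous_on_spin_product)
  have r: "continuous_on S r"
    unfolding r_def by (intro continuous_intros continuous_on_dissipation)
  have der: "((\<lambda>s. W (u s)) has_real_derivative r (u t) * W (u t)) (at t within T)"
    if "solution (p_het l \<epsilon>) T u" "t \<in> T" for T u t
    unfolding W_def r_def using spin_product_square_derivative[OF l that] .
  define D where "D p = - (r p * W p)" for p
  have D: "continuous_on S D" "\<And>p. D p \<ge> 0"
  proof -
    show "continuous_on S D" unfolding D_def by (intro continuous_intros r W(1))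
    show "D p \<ge> 0" for p
      using W(2)[of p] dissipation_nonneg[of l p] assms(2) by (simp add: D_def r_def)
  qed
  have der_D: "((\<lambda>s. W (u s)) has_real_derivative - D (u t)) (at t within T)"
    if "solution (p_het l \<epsilon>) T u" "t \<in> T" for T u t
    using der[OF that] by (simp add: D_def)
  have "c > 0" using assms by (simp add: c_def)
  have D_pos: "D p > 0" if "p \<in> S" "0 < W p" "W p < c" for p
    using dissipation_pos[OF l, of p M] that assms(2)
    by (simp add: D_def W_def S_def m_def c_def r_def)
  have stable: "asymptotically_stable_invariant_on (p_het l \<epsilon>) S {p \<in> S. W p = 0}"
    unfolding asymptotically_stable_invariant_on_def
    using zero_set_invariant[OF S W(2) r der] Lyapunov_stable_on[OF S W D(2) der_D]
      Lyapunov_locally_attracting_on[OF S W D \<open>c > 0\<close> D_pos der_D p_het_global_solution]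
    by auto
  have unstable: "unstable_equilibrium (rattleback l) (- e3 m)" "unstable_equilibrium (rattleback l) (e3 m)"
      "unstable_equilibrium (p_het l \<epsilon>) (- e3 m)" "unstable_equilibrium (p_het l \<epsilon>) (e3 m)"
    using nonempty orbits_subset by (blast intro: heteroclinic_orbit_source_unstable)+
  have invariant: "invariant_set (rattleback l) S"
    unfolding S_def p_het_0[symmetric] by (rule p_het_invariant_sphere)
  have levels: "energy_Casimir l -` {(0, M\<^sup>2 / 2)} = {p \<in> S. W p = 0}" "Casimir -` {M\<^sup>2 / 2} = S"
    unfolding energy_Casimir_level Casimir_level S_def W_def m_def by (rule refl)+
  have cycles: "{p \<in> S. W p = 0} = heteroclinic_cycles (rattleback l) (- e3 m) (e3 m)"
    unfolding heteroclinic_cycles_eq[OF l m] S_def W_def ..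
  show ?thesis
    unfolding asymptotically_stabilizes_cycles_def m_def[symmetric] levels
    by (intro conjI unstable cycles invariant S(2) orbits_subset stable)
qed

end
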